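(* Let $b\in\mathcal{C}_A$. Then $b$ belongs to the topological interior of $\mathcal{C}_A$ in $\mathbb{R}^N$ if and only if $$\dim Q_{A,b}=d\quad\text{and}\quad \dim Q_{A,b}^k=d-1\quad\forall\,k\in\{1,\ldots,N\}.$$
   Context: Let $A\in\mathbb{R}^{N\times d}$ be a fixed matrix whose rows $a_1^T,\ldots,a_N^T$ are pairwise distinct and satisfy $\|a_i\|_2=1$ for $i=1,\ldots,N$. For $b\in\mathbb{R}^N$ put $Q_{A,b}:=\{x\in\mathbb{R}^d:Ax\le b\}$, and set $$\mathcal{C}_A:=\{b\in\mathbb{R}^N:\ \forall\, i\in\{1,\ldots,N\}\ \exists\, x_i\in Q_{A,b}\ \text{with}\ a_i^Tx_i=b_i\}.$$ For $b\in\mathcal{C}_A$ and $k\in\{1,\ldots,N\}$ put $Q_{A,b}^k:=Q_{A,b}\cap\{x\in\mathbb{R}^d:a_k^Tx=b_k\}$. The dimension of a nonempty convex set is the dimension of its affine hull. *)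

theory Defs
  imports "HOL-Analysis.Analysis"
begin

(* The order on vectors is componentwise. *)

definition polyhedron_Q :: "real^'d^'n \<Rightarrow> real^'n \<Rightarrow> (real^'d) set" where
  "polyhedron_Q A b = {x. A *v x \<le> b}"

definition consistent_C :: "real^'d^'n \<Rightarrow> (real^'n) set" where
  "consistent_C A = {b. \<forall>i. \<exists>x \<in> polyhedron_Q A b. row i A \<bullet> x = b $ i}"

definition face_Q :: "real^'d^'n \<Rightarrow> real^'n \<Rightarrow> 'n \<Rightarrow> (real^'d) set" where
  "face_Q A b k = polyhedron_Q A b \<inter> {x. row k A \<bullet> x = b $ k}"

end

theory Submission
  imports Defs
begin

text \<open>
  Both sides of the equivalence say the same thing about the inequality system: for every \<open>k\<close>
  there is a point at which the \<open>k\<close>-th inequality is tight and all the others are strict.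

  For the interior this is a matter of perturbing \<open>b\<close>. Lowering every entry of \<open>b\<close> except the
  \<open>k\<close>-th a little, and still finding a consistent right-hand side, yields such a point
  (\<open>exposed_if_interior\<close>). Conversely, moving such a point along the unit normal \<open>a\<^sub>k\<close> lets it
  follow small changes of \<open>b\<close> (\<open>interior_if_exposed\<close>).

  For the dimensions, near such a point the polyhedron coincides with a half-space and its face
  with a hyperplane (\<open>dims_if_exposed\<close>). Conversely, a relative interior point of the face is the
  required point: if another inequality were tight there, it would be tight on the whole face,
  whose affine hull is the hyperplane of the \<open>k\<close>-th inequality. Two distinct unit normals
  defining the same hyperplane are opposite, and then the polyhedron lies in that hyperplane,
  against full dimension (\<open>exposed_if_dims\<close>).
\<close>

definition exposed_points :: "real^'d^'n \<Rightarrow> real^'n \<Rightarrow> 'n \<Rightarrow> (real^'d) set" where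
  "exposed_points A b k = {x. row k A \<bullet> x = b $ k \<and> (\<forall>i. i \<noteq> k \<longrightarrow> row i A \<bullet> x < b $ i)}"

lemma mem_polyhedron_Q: "x \<in> polyhedron_Q A b \<longleftrightarrow> (\<forall>i. row i A \<bullet> x \<le> b $ i)"
  by (simp add: polyhedron_Q_def less_eq_vec_def matrix_vector_mul_component row_def vec_lambda_eta)

lemma mem_face_Q:
  "x \<in> face_Q A b k \<longleftrightarrow> (\<forall>i. row i A \<bullet> x \<le> b $ i) \<and> row k A \<bullet> x = b $ k"
  by (simp add: face_Q_def mem_polyhedron_Q)

lemma convex_face_Q: "convex (face_Q A b k)"
proof -
  have "face_Q A b k = (\<Inter>i. {x. row i A \<bullet> x \<le> b $ i}) \<inter> {x. row k A \<bullet> x = b $ k}"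
    by (auto simp: mem_face_Q)
  also have "convex \<dots>"
    by (intro convex_Int convex_INT convex_halfspace_le convex_hyperplane)
  finally show ?thesis .
qed

lemma exposed_if_interior:
  fixes A :: "real^'d^'n" and b :: "real^'n"
  assumes "b \<in> interior (consistent_C A)"
  shows "exposed_points A b k \<noteq> {}"
proof -
  obtain e where e: "e > 0" "ball b e \<subseteq> consistent_C A"
    using assms by (auto simp: mem_interior)
  define v :: "real^'n" where "v = (\<chi> i. if i = k then 0 else 1)"
  \<comment> \<open>The denominator is shifted by one since \<open>v\<close> vanishes when there is a single row.\<close>
  define s where "s = e / (norm v + 1)"
  have s: "s > 0"
    using e(1) by (simp add: s_def add_nonneg_pos)
  have "s * norm v < s * (norm v + 1)"
    using s by simp
  also have "\<dots> = e"
    by (simp add: s_def add_nonneg_eq_0_iff)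
  finally have "b - s *\<^sub>R v \<in> ball b e"
    using s by (simp add: dist_norm)
  then have "b - s *\<^sub>R v \<in> consistent_C A"
    using e(2) by blast
  then obtain x where x: "x \<in> polyhedron_Q A (b - s *\<^sub>R v)" "row k A \<bullet> x = (b - s *\<^sub>R v) $ k"
    by (auto simp: consistent_C_def)
  have "row i A \<bullet> x < b $ i" if "i \<noteq> k" for i
  proof -
    have "row i A \<bullet> x \<le> (b - s *\<^sub>R v) $ i"
      using x(1) by (simp add: mem_polyhedron_Q)
    then show ?thesis
      using s that by (simp add: v_def)
  qed
  moreover have "row k A \<bullet> x = b $ k"
    using x(2) by (simp add: v_def)
  ultimately show ?thesis
    by (auto simp: exposed_points_def)
qed

text \<open>
  The point \<open>x\<^sub>k + (b'\<^sub>k - b\<^sub>k) a\<^sub>k\<close> is tight for the \<open>k\<close>-th inequality of the perturbed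
  right-hand side \<open>b'\<close> because \<open>a\<^sub>k\<close> is a unit vector. It depends continuously on \<open>b'\<close>, so the
  finitely many strict inequalities survive.
\<close>
lemma interior_if_exposed:
  fixes A :: "real^'d^'n" and b :: "real^'n"
  assumes unit_rows: "\<And>i. norm (row i A) = 1"
    and exposed: "\<And>k. exposed_points A b k \<noteq> {}"
  shows "b \<in> interior (consistent_C A)"
proof -
  obtain x where tight: "\<And>k. row k A \<bullet> x k = b $ k"
    and strict: "\<And>k i. i \<noteq> k \<Longrightarrow> row i A \<bullet> x k < b $ i"
  proof -
    have "\<forall>k. \<exists>y. y \<in> exposed_points A b k"
      using exposed by blast
    then obtain x where "\<And>k. x k \<in> exposed_points A b k"
      by metis
    then show ?thesis
      using that[of x] by (simp add: exposed_points_def)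
  qed
  define y where "y = (\<lambda>c k. x k + (c $ k - b $ k) *\<^sub>R row k A)"
  have "\<forall>\<^sub>F c in nhds b. row i A \<bullet> y c k < c $ i" if "i \<noteq> k" for i k
  proof -
    have "((\<lambda>c. c $ i - row i A \<bullet> y c k) \<longlongrightarrow> b $ i - row i A \<bullet> y b k) (nhds b)"
      unfolding y_def by (intro tendsto_intros filterlim_ident)
    moreover have "0 < b $ i - row i A \<bullet> y b k"
      using strict[OF that] by (simp add: y_def)
    ultimately have "\<forall>\<^sub>F c in nhds b. 0 < c $ i - row i A \<bullet> y c k"
      by (rule order_tendstoD)
    then show ?thesis
      by simp
  qed
  then have "\<forall>\<^sub>F c in nhds b. \<forall>k i. i \<noteq> k \<longrightarrow> row i A \<bullet> y c k < c $ i"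
    by (simp add: eventually_all_finite)
  moreover have "c \<in> consistent_C A" if c: "\<forall>k i. i \<noteq> k \<longrightarrow> row i A \<bullet> y c k < c $ i" for c
  proof -
    have eq: "row k A \<bullet> y c k = c $ k" for k
      using tight[of k] unit_rows[of k] by (simp add: y_def inner_add_right norm_eq_1)
    have "y c k \<in> polyhedron_Q A c" for k
      unfolding mem_polyhedron_Q
    proof
      fix i
      show "row i A \<bullet> y c k \<le> c $ i"
        using c eq by (cases "i = k") (auto intro: less_imp_le)
    qed
    then show ?thesis
      using eq by (auto simp: consistent_C_def)
  qed
  ultimately have "\<forall>\<^sub>F c in nhds b. c \<in> consistent_C A"
    by (auto elim: eventually_mono)
  then show ?thesis
    by (auto simp: eventually_nhds interior_def)
qed

text \<open>
  The strict inequalities cut out an open set. Intersecting a convex set with an open set that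
  meets it does not lower the dimension.
\<close>
lemma dims_if_exposed:
  fixes A :: "real^'d^'n" and b :: "real^'n"
  assumes nonzero: "row k A \<noteq> 0"
    and exposed: "exposed_points A b k \<noteq> {}"
  shows "aff_dim (polyhedron_Q A b) = int CARD('d)"
    and "aff_dim (face_Q A b k) = int CARD('d) - 1"
proof -
  define U where "U = (\<Inter>i\<in>-{k}. {x. row i A \<bullet> x < b $ i})"
  define H where "H = {x. row k A \<bullet> x = b $ k}"
  define L where "L = {x. row k A \<bullet> x \<le> b $ k}"
  have U: "open U"
    unfolding U_def by (intro open_INT) (auto simp: open_halfspace_lt)
  obtain p where "p \<in> exposed_points A b k"
    using exposed by blast
  then have "p \<in> H \<inter> U" "p \<in> L \<inter> U"
    by (simp_all add: exposed_points_def H_def L_def U_def)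
  then have meet: "H \<inter> U \<noteq> {}" "L \<inter> U \<noteq> {}"
    by blast+
  have le: "row i A \<bullet> x \<le> b $ i" if "x \<in> L" "x \<in> U" for x i
    using that by (cases "i = k") (auto simp: L_def U_def intro: less_imp_le)
  have dimL: "aff_dim (L \<inter> U) = int CARD('d)"
    using aff_dim_convex_Int_open[OF _ U meet(2)] nonzero
    by (simp add: L_def convex_halfspace_le aff_dim_halfspace_le)
  have dimH: "aff_dim (H \<inter> U) = int CARD('d) - 1"
    using aff_dim_convex_Int_open[OF _ U meet(1)] nonzero
    by (simp add: H_def convex_hyperplane aff_dim_hyperplane)
  have "L \<inter> U \<subseteq> polyhedron_Q A b"
    using le by (auto simp: mem_polyhedron_Q)
  then have "int CARD('d) \<le> aff_dim (polyhedron_Q A b)"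
    using dimL aff_dim_subset by metis
  then show "aff_dim (polyhedron_Q A b) = int CARD('d)"
    using aff_dim_le_DIM[of "polyhedron_Q A b"] by simp
  have "H \<inter> U \<subseteq> face_Q A b k"
    using le by (auto simp: mem_face_Q H_def L_def)
  then have "int CARD('d) - 1 \<le> aff_dim (face_Q A b k)"
    using dimH aff_dim_subset by metis
  moreover have "face_Q A b k \<subseteq> H"
    by (auto simp: mem_face_Q H_def)
  then have "aff_dim (face_Q A b k) \<le> aff_dim H"
    by (rule aff_dim_subset)
  moreover have "aff_dim H = int CARD('d) - 1"
    using nonzero by (simp add: H_def aff_dim_hyperplane)
  ultimately show "aff_dim (face_Q A b k) = int CARD('d) - 1"
    by linarith
qed

text \<open>
  The hyperplane of \<open>u\<close> contains its foot point \<open>\<beta> u\<close>, and that point shifted by the component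
  of \<open>w\<close> orthogonal to \<open>u\<close>. Since both lie on the hyperplane of \<open>w\<close>, the orthogonal component
  vanishes, that is \<open>(w \<bullet> u)\<^sup>2 = 1\<close>.
\<close>
lemma unit_normals_of_same_hyperplane:
  fixes u w :: "'a::real_inner"
  assumes "norm u = 1" "norm w = 1" "u \<noteq> w"
    and sub: "{x. u \<bullet> x = \<beta>} \<subseteq> {x. w \<bullet> x = \<gamma>}"
  shows "w = - u" and "\<gamma> = - \<beta>"
proof -
  have uu: "u \<bullet> u = 1" and ww: "w \<bullet> w = 1"
    using assms by (simp_all add: norm_eq_1)
  define c where "c = w \<bullet> u"
  have uw: "u \<bullet> w = c"
    by (simp add: c_def inner_commute)
  have "\<beta> *\<^sub>R u \<in> {x. u \<bullet> x = \<beta>}"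
    by (simp add: uu)
  then have "w \<bullet> (\<beta> *\<^sub>R u) = \<gamma>"
    using sub by blast
  then have foot: "\<beta> * c = \<gamma>"
    by (simp add: c_def)
  have "\<beta> *\<^sub>R u + (w - c *\<^sub>R u) \<in> {x. u \<bullet> x = \<beta>}"
    by (simp add: uu uw inner_simps)
  then have "w \<bullet> (\<beta> *\<^sub>R u + (w - c *\<^sub>R u)) = \<gamma>"
    using sub by blast
  then have "c * c = 1"
    using foot by (simp add: ww inner_simps c_def[symmetric])
  moreover have "c \<noteq> 1"
  proof
    assume "c = 1"
    then have "(w - u) \<bullet> (w - u) = 0"
      by (simp add: inner_diff_left inner_diff_right uu ww uw c_def[symmetric])
    then show False
      using \<open>u \<noteq> w\<close> by simp
  qed
  ultimately have c: "c = -1"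
    by (simp add: square_eq_1_iff)
  then have "(w + u) \<bullet> (w + u) = 0"
    by (simp add: inner_add_left inner_add_right uu ww uw c_def[symmetric])
  then show "w = - u"
    by (simp add: eq_neg_iff_add_eq_0)
  show "\<gamma> = - \<beta>"
    using foot c by simp
qed

text \<open>
  From any \<open>x \<in> S\<close> the segment to a relative interior point \<open>z\<close> can be prolonged beyond \<open>z\<close>
  within \<open>S\<close>. If the functional were smaller at \<open>x\<close> than at \<open>z\<close>, it would exceed the bound there.
\<close>
lemma tight_at_rel_interior_imp_tight:
  fixes S :: "'a::euclidean_space set"
  assumes "convex S" "z \<in> rel_interior S" "a \<bullet> z = \<beta>"
    and bound: "\<And>x. x \<in> S \<Longrightarrow> a \<bullet> x \<le> \<beta>"
    and "x \<in> S"
  shows "a \<bullet> x = \<beta>"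
proof -
  have "S \<noteq> {}"
    using assms by blast
  then obtain e where e: "e > 1" "(1 - e) *\<^sub>R x + e *\<^sub>R z \<in> S"
    using convex_rel_interior_iff[OF \<open>convex S\<close>] assms by blast
  have "(1 - e) * (a \<bullet> x) + e * \<beta> \<le> \<beta>"
    using bound[OF e(2)] assms(3) by (simp add: inner_add_right)
  then have "(e - 1) * \<beta> \<le> (e - 1) * (a \<bullet> x)"
    by (simp add: algebra_simps)
  then have "\<beta> \<le> a \<bullet> x"
    using e(1) by simp
  with bound[OF \<open>x \<in> S\<close>] show ?thesis
    by simp
qed

lemma exposed_if_dims:
  fixes A :: "real^'d^'n" and b :: "real^'n"
  assumes distinct_rows: "\<And>i j. i \<noteq> j \<Longrightarrow> row i A \<noteq> row j A"
    and unit_rows: "\<And>i. norm (row i A) = 1"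
    and dimQ: "aff_dim (polyhedron_Q A b) = int CARD('d)"
    and dimF: "aff_dim (face_Q A b k) = int CARD('d) - 1"
  shows "exposed_points A b k \<noteq> {}"
proof -
  let ?F = "face_Q A b k" and ?H = "\<lambda>i. {x. row i A \<bullet> x = b $ i}"
  have nonzero: "row k A \<noteq> 0"
    using unit_rows[of k] by force
  have dimH: "aff_dim (?H k) = int CARD('d) - 1"
    using nonzero by (simp add: aff_dim_hyperplane)
  have "?F \<noteq> {}"
  proof
    assume "?F = {}"
    then show False
      using dimF by simp
  qed
  then obtain z where z: "z \<in> rel_interior ?F"
    using rel_interior_eq_empty[OF convex_face_Q] by blast
  then have zF: "z \<in> ?F"
    using rel_interior_subset by blast
  have "row i A \<bullet> z \<noteq> b $ i" if "i \<noteq> k" for i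
  proof
    assume tight: "row i A \<bullet> z = b $ i"
    have F: "?F \<subseteq> ?H i"
      using tight_at_rel_interior_imp_tight[OF convex_face_Q z tight] by (auto simp: mem_face_Q)
    have "?F \<subseteq> ?H k"
      by (auto simp: mem_face_Q)
    then have "affine hull ?F = affine hull ?H k"
      using aff_dim_eq_full_gen dimF dimH by metis
    also have "\<dots> = ?H k"
      by (simp add: affine_hyperplane hull_same)
    finally have "?H k \<subseteq> ?H i"
      using hull_minimal[of ?F "?H i" affine, OF F] by (simp add: affine_hyperplane)
    then have opposite: "row i A = - row k A" "b $ i = - b $ k"
      using unit_normals_of_same_hyperplane[OF unit_rows unit_rows distinct_rows] that by metis+
    have "polyhedron_Q A b \<subseteq> ?H k"
    proof
      fix x assume "x \<in> polyhedron_Q A b"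
      then have "row k A \<bullet> x \<le> b $ k" "row i A \<bullet> x \<le> b $ i"
        by (simp_all add: mem_polyhedron_Q)
      then show "x \<in> ?H k"
        using opposite by simp
    qed
    then have "aff_dim (polyhedron_Q A b) \<le> aff_dim (?H k)"
      by (rule aff_dim_subset)
    then show False
      using dimQ dimH by simp
  qed
  then have "z \<in> exposed_points A b k"
    using zF by (auto simp: exposed_points_def mem_face_Q order_less_le)
  then show ?thesis
    by blast
qed

theorem theorem36:
  fixes A :: "real^'d^'n" and b :: "real^'n"
  assumes distinct_rows: "\<And>i j. i \<noteq> j \<Longrightarrow> row i A \<noteq> row j A"
    and unit_rows: "\<And>i. norm (row i A) = 1"
    and b_in: "b \<in> consistent_C A"
  shows "b \<in> interior (consistent_C A) \<longleftrightarrow>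
    aff_dim (polyhedron_Q A b) = int CARD('d) \<and>
    (\<forall>k. aff_dim (face_Q A b k) = int CARD('d) - 1)"
proof -
  have "row k A \<noteq> 0" for k
    using unit_rows[of k] by force
  then have "(\<forall>k. exposed_points A b k \<noteq> {}) \<longleftrightarrow>
    aff_dim (polyhedron_Q A b) = int CARD('d) \<and>
    (\<forall>k. aff_dim (face_Q A b k) = int CARD('d) - 1)"
    using dims_if_exposed exposed_if_dims[OF distinct_rows unit_rows] by blast
  moreover have "b \<in> interior (consistent_C A) \<longleftrightarrow> (\<forall>k. exposed_points A b k \<noteq> {})"
    using exposed_if_interior interior_if_exposed[OF unit_rows] by blast
  ultimately show ?thesis
    by simp
qed

end
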